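(* $$[\mathbb{O}^-]\circledcirc[\mathbb{O}\oplus\mathbb{Z}_2^c]=\{[\mathbb{1}],[\mathbb{Z}_2],[\mathbb{Z}_2^-],[\mathbb{Z}_3],[\mathbb{Z}_4^-],[\mathbb{D}_2^z],[\mathbb{D}_3^z],[\mathbb{D}_4^d],[\mathbb{O}^-]\}.$$
   Context: $[K]$ is the conjugacy class of a subgroup $K$ in $\mathrm{O}(3)$, and the clips operation is $[H_1]\circledcirc[H_2]=\{[H_1\cap gH_2g^{-1}]:g\in\mathrm{O}(3)\}$. $(e_1,e_2,e_3)$ is the canonical basis of $\mathbb{R}^3$, $\mathbf{r}(n,\theta)$ is the rotation by angle $\theta$ about the axis directed by $n\neq0$. $\mathbb{1}=\{\mathrm{Id}\}$; $\mathbb{Z}_2^c=\{\pm\mathrm{Id}\}$; $H\oplus\mathbb{Z}_2^c=H\cup(-H)$ for $H\subset\mathrm{SO}(3)$; $\mathbb{Z}_k=\{\mathbf{r}(e_3,2j\pi/k):0\le j\le k-1\}$; $\mathbb{D}_k=\langle\mathbf{r}(e_3,2\pi/k),\mathbf{r}(e_1,\pi)\rangle$ for $k\ge2$; $\mathbb{Z}_{2k}^-=\mathbb{Z}_k\cup(-\mathbf{r}(e_3,\pi/k))\mathbb{Z}_k$ for $k\ge1$; $\mathbb{D}_k^z=\mathbb{Z}_k\cup(-\mathbf{r}(e_1,\pi))\mathbb{Z}_k$ for $k\ge2$; $\mathbb{D}_{2k}^d=\mathbb{D}_k\cup(-\mathbf{r}(e_3,\pi/k))\mathbb{D}_k$ (the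 superscript $d$ is part of the name). $\mathbb{T}$ is the rotation group of the regular tetrahedron (order 12), generated by $\mathbf{r}(e_3,\pi),\mathbf{r}(e_1,\pi),\mathbf{r}(e_1+e_2+e_3,2\pi/3)$; $\mathbb{O}$ is the rotation group of the cube (order 24), generated by $\mathbf{r}(e_3,\pi/2),\mathbf{r}(e_1,\pi),\mathbf{r}(e_1+e_2+e_3,2\pi/3)$; $\mathbb{O}^-=\mathbb{T}\cup(-\mathbf{r}(e_3,\pi/2))\mathbb{T}$. *)

theory Defs
  imports "HOL-Analysis.Analysis" "HOL-Algebra.Generated_Groups"
begin

definition O3 :: "(real^3^3) monoid" where
  "O3 = \<lparr>carrier = {A. orthogonal_matrix A}, mult = (**), one = mat 1\<rparr>"

lemma group_O3: "group O3"
proof (rule groupI)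
  fix A assume "A \<in> carrier O3"
  then show "\<exists>B\<in>carrier O3. B \<otimes>\<^bsub>O3\<^esub> A = \<one>\<^bsub>O3\<^esub>"
    by (intro bexI[of _ "transpose A"]) (auto simp: O3_def orthogonal_matrix_def)
qed (auto simp: O3_def orthogonal_matrix_mul orthogonal_matrix_id matrix_mul_assoc)

definition conj_by :: "real^3^3 \<Rightarrow> (real^3^3) set \<Rightarrow> (real^3^3) set" where
  "conj_by g H = g <#\<^bsub>O3\<^esub> H #>\<^bsub>O3\<^esub> (inv\<^bsub>O3\<^esub> g)"

definition conj_class :: "(real^3^3) set \<Rightarrow> (real^3^3) set set" where
  "conj_class K = {conj_by g K |g. g \<in> carrier O3}"

(* The clips operation takes conjugacy classes as arguments, so its definition ranges over
   all representatives; that any fixed pair of representatives yields the same set is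
   the lemma clips_conj_class below. *)
definition clips :: "(real^3^3) set set \<Rightarrow> (real^3^3) set set \<Rightarrow> (real^3^3) set set set" where
  "clips C1 C2 =
     {conj_class (H1 \<inter> conj_by g H2) |H1 H2 g. H1 \<in> C1 \<and> H2 \<in> C2 \<and> g \<in> carrier O3}"

lemma conj_by_image: "conj_by g H = (\<lambda>h. g \<otimes>\<^bsub>O3\<^esub> h \<otimes>\<^bsub>O3\<^esub> inv\<^bsub>O3\<^esub> g) ` H"
  by (auto simp: conj_by_def l_coset_def r_coset_def)

lemma conj_by_closed: "g \<in> carrier O3 \<Longrightarrow> H \<subseteq> carrier O3 \<Longrightarrow> conj_by g H \<subseteq> carrier O3"
proof -
  interpret group O3 by (rule group_O3)
  show "g \<in> carrier O3 \<Longrightarrow> H \<subseteq> carrier O3 \<Longrightarrow> conj_by g H \<subseteq> carrier O3"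
    by (auto simp: conj_by_image)
qed

lemma conj_by_one: "H \<subseteq> carrier O3 \<Longrightarrow> conj_by \<one>\<^bsub>O3\<^esub> H = H"
proof -
  interpret group O3 by (rule group_O3)
  assume "H \<subseteq> carrier O3"
  then have "conj_by \<one>\<^bsub>O3\<^esub> H = (\<lambda>h. h) ` H"
    unfolding conj_by_image by (intro image_cong) auto
  then show ?thesis by simp
qed

lemma conj_by_mult:
  assumes "g \<in> carrier O3" "k \<in> carrier O3" "H \<subseteq> carrier O3"
  shows "conj_by g (conj_by k H) = conj_by (g \<otimes>\<^bsub>O3\<^esub> k) H"
proof -
  interpret group O3 by (rule group_O3)
  show ?thesis
    unfolding conj_by_image image_image
    using assms by (intro image_cong) (auto simp: m_assoc inv_mult_group subset_iff)
qed

lemma conj_by_Int: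
  assumes "g \<in> carrier O3" "H \<subseteq> carrier O3" "K \<subseteq> carrier O3"
  shows "conj_by g (H \<inter> K) = conj_by g H \<inter> conj_by g K"
proof -
  interpret group O3 by (rule group_O3)
  have "inj_on (\<lambda>h. g \<otimes>\<^bsub>O3\<^esub> h \<otimes>\<^bsub>O3\<^esub> inv\<^bsub>O3\<^esub> g) (carrier O3)"
    using assms(1) by (auto intro!: inj_onI)
  then show ?thesis
    unfolding conj_by_image using assms by (intro inj_on_image_Int) auto
qed

lemma conj_class_conj_by:
  assumes "a \<in> carrier O3" "H \<subseteq> carrier O3"
  shows "conj_class (conj_by a H) = conj_class H"
proof -
  interpret group O3 by (rule group_O3)
  have "conj_by g (conj_by a H) \<in> conj_class H" if "g \<in> carrier O3" for g
    using assms that conj_by_mult unfolding conj_class_def by blast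
  moreover have "conj_by g H \<in> conj_class (conj_by a H)" if "g \<in> carrier O3" for g
  proof -
    have "conj_by g H = conj_by (g \<otimes>\<^bsub>O3\<^esub> inv\<^bsub>O3\<^esub> a) (conj_by a H)"
      using assms that by (simp add: conj_by_mult m_assoc)
    then show ?thesis using assms that unfolding conj_class_def by blast
  qed
  ultimately show ?thesis by (auto simp: conj_class_def[of H] conj_class_def[of "conj_by a H"])
qed

lemma clips_conj_class:
  assumes H1: "H1 \<subseteq> carrier O3" and H2: "H2 \<subseteq> carrier O3"
  shows "clips (conj_class H1) (conj_class H2) =
           {conj_class (H1 \<inter> conj_by g H2) |g. g \<in> carrier O3}" (is "?L = ?R")
proof
  interpret group O3 by (rule group_O3)
  show "?L \<subseteq> ?R"
  proof
    fix C assume "C \<in> ?L"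
    then obtain a b g where abg: "a \<in> carrier O3" "b \<in> carrier O3" "g \<in> carrier O3"
      and C: "C = conj_class (conj_by a H1 \<inter> conj_by g (conj_by b H2))"
      unfolding clips_def conj_class_def by blast
    define k where "k = inv\<^bsub>O3\<^esub> a \<otimes>\<^bsub>O3\<^esub> (g \<otimes>\<^bsub>O3\<^esub> b)"
    have k: "k \<in> carrier O3" using abg by (simp add: k_def)
    have ak: "a \<otimes>\<^bsub>O3\<^esub> k = g \<otimes>\<^bsub>O3\<^esub> b"
      using abg by (simp add: k_def m_assoc[symmetric])
    have "conj_by a H1 \<inter> conj_by g (conj_by b H2) = conj_by a (H1 \<inter> conj_by k H2)"
      using abg k H1 H2 by (simp add: conj_by_Int conj_by_mult conj_by_closed ak)
    then have "C = conj_class (H1 \<inter> conj_by k H2)"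
      using C abg H1 by (simp add: conj_class_conj_by le_infI1)
    then show "C \<in> ?R" using k by blast
  qed
  have "H1 \<in> conj_class H1" "H2 \<in> conj_class H2"
    using conj_by_one[OF H1] conj_by_one[OF H2] one_closed unfolding conj_class_def by force+
  then show "?R \<subseteq> ?L" unfolding clips_def by blast
qed

abbreviation e1 :: "real^3" where "e1 \<equiv> axis 1 1"
abbreviation e2 :: "real^3" where "e2 \<equiv> axis 2 1"
abbreviation e3 :: "real^3" where "e3 \<equiv> axis 3 1"

(* Rodrigues' formula for the right-handed rotation by theta about the axis directed by n \<noteq> 0;
   sgn n is the unit vector n / norm n. *)
definition rot :: "real^3 \<Rightarrow> real \<Rightarrow> real^3^3" where
  "rot n \<theta> = matrix (\<lambda>x. cos \<theta> *\<^sub>R x + sin \<theta> *\<^sub>R cross3 (sgn n) x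
                          + ((1 - cos \<theta>) * (sgn n \<bullet> x)) *\<^sub>R sgn n)"

definition oplus_Z2c :: "(real^3^3) set \<Rightarrow> (real^3^3) set" where
  "oplus_Z2c H = H \<union> uminus ` H"

definition Z_rot :: "nat \<Rightarrow> (real^3^3) set" where
  "Z_rot k = {rot e3 (2 * real j * pi / real k) |j. j < k}"

definition D_rot :: "nat \<Rightarrow> (real^3^3) set" where
  "D_rot k = generate O3 {rot e3 (2 * pi / real k), rot e1 pi}"

(* The argument of Z2k_minus and D2k_d is k, half of the index in the usual names:
   Z2k_minus 2 is Z_4^-, and D2k_d 2 is D_4^d. *)
definition Z2k_minus :: "nat \<Rightarrow> (real^3^3) set" where
  "Z2k_minus k = Z_rot k \<union> ((- rot e3 (pi / real k)) <#\<^bsub>O3\<^esub> Z_rot k)"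

definition D_z :: "nat \<Rightarrow> (real^3^3) set" where
  "D_z k = Z_rot k \<union> ((- rot e1 pi) <#\<^bsub>O3\<^esub> Z_rot k)"

definition D2k_d :: "nat \<Rightarrow> (real^3^3) set" where
  "D2k_d k = D_rot k \<union> ((- rot e3 (pi / real k)) <#\<^bsub>O3\<^esub> D_rot k)"

definition Tet :: "(real^3^3) set" where
  "Tet = generate O3 {rot e3 pi, rot e1 pi, rot (e1 + e2 + e3) (2 * pi / 3)}"

definition Oct :: "(real^3^3) set" where
  "Oct = generate O3 {rot e3 (pi / 2), rot e1 pi, rot (e1 + e2 + e3) (2 * pi / 3)}"

definition Oct_minus :: "(real^3^3) set" where
  "Oct_minus = Tet \<union> ((- rot e3 (pi / 2)) <#\<^bsub>O3\<^esub> Tet)"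

end

theory Submission
  imports Defs
begin

text \<open>
  The group \<open>\<O> \<oplus> \<Z>\<^sub>2\<^sup>c\<close> consists of the signed permutation matrices, that is, of
  the orthogonal matrices with entries in \<open>{-1, 0, 1}\<close>, and \<open>\<O>\<^sup>-\<close> of those signed
  permutations that leave the polynomial \<open>xyz\<close> invariant (\<open>Oct_minus_eq\<close>, \<open>oplus_Oct_eq\<close>).
  The latter is the semidirect product of the Klein group \<open>V\<close> of the half-turns about the
  coordinate axes with the group of the six permutation matrices, hence a copy of the symmetric
  group on four letters. What has to be determined is which classes occur among the groups
  \<open>H = \<O>\<^sup>- \<inter> g (\<O> \<oplus> \<Z>\<^sub>2\<^sup>c) g\<^sup>-\<^sup>1\<close> for orthogonal \<open>g\<close>.

  If \<open>H\<close> does not contain \<open>V\<close>, then \<open>H \<inter> V\<close> has at most two elements. If \<open>H \<inter> V\<close> is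
  trivial, \<open>H\<close> embeds into the group of coordinate permutations, and up to conjugation it
  is trivial, generated by one reflection, generated by one rotation of order three, or the group
  of all permutation matrices. If \<open>H \<inter> V\<close> is generated by one half-turn, \<open>H\<close>
  centralises it, which leaves three groups (\<open>conj_class_subgroup_tetra_full\<close>).

  The group-theoretic possibilities that must be excluded, \<open>\<D>\<^sub>2\<close> and \<open>\<T>\<close>, both contain \<open>V\<close>,
  and here the geometry of \<open>g\<close> enters. If \<open>V\<close> lies in the conjugate of the signed
  permutations by \<open>g\<close>, the squares of the entries of \<open>g\<close> lie in \<open>{0, 1/2, 1}\<close>. Together with the
  orthogonality of the rows this makes \<open>g\<close> either a signed permutation itself or, up to signed
  permutations on both sides, the rotation by \<open>\<pi>/4\<close> about a coordinate axis
  (\<open>half_turns_in_conj_signed_perms\<close>). In the first case \<open>H\<close> is all of \<open>\<O>\<^sup>-\<close>, in the second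
  it is conjugate to \<open>\<D>\<^sub>4\<^sup>d\<close>.

  Conversely, each class is realised by an explicit \<open>g\<close> that aligns the desired symmetry
  elements of the two groups and is otherwise generic. An element \<open>x\<close> lies in the conjugate exactly
  if \<open>g\<^sup>T x g\<close> has entries in \<open>{-1, 0, 1}\<close>, so each intersection is a check of 24 matrices.
\<close>

section \<open>Concrete three by three matrices\<close>

definition mat3 :: "real \<Rightarrow> real \<Rightarrow> real \<Rightarrow> real \<Rightarrow> real \<Rightarrow> real \<Rightarrow> real \<Rightarrow> real \<Rightarrow> real \<Rightarrow> real^3^3"
  where "mat3 a b c d e f g h i = vector [vector [a, b, c], vector [d, e, f], vector [g, h, i]]"

lemma mat3_nth [simp]:
  "mat3 a b c d e f g h i $ 1 $ 1 = a" "mat3 a b c d e f g h i $ 1 $ 2 = b"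
  "mat3 a b c d e f g h i $ 1 $ 3 = c" "mat3 a b c d e f g h i $ 2 $ 1 = d"
  "mat3 a b c d e f g h i $ 2 $ 2 = e" "mat3 a b c d e f g h i $ 2 $ 3 = f"
  "mat3 a b c d e f g h i $ 3 $ 1 = g" "mat3 a b c d e f g h i $ 3 $ 2 = h"
  "mat3 a b c d e f g h i $ 3 $ 3 = i"
  by (simp_all add: mat3_def)

lemma matrix3_eq_iff:
  fixes A B :: "real^3^3"
  shows "A = B \<longleftrightarrow>
    A $ 1 $ 1 = B $ 1 $ 1 \<and> A $ 1 $ 2 = B $ 1 $ 2 \<and> A $ 1 $ 3 = B $ 1 $ 3 \<and>
    A $ 2 $ 1 = B $ 2 $ 1 \<and> A $ 2 $ 2 = B $ 2 $ 2 \<and> A $ 2 $ 3 = B $ 2 $ 3 \<and>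
    A $ 3 $ 1 = B $ 3 $ 1 \<and> A $ 3 $ 2 = B $ 3 $ 2 \<and> A $ 3 $ 3 = B $ 3 $ 3"
  by (auto simp: vec_eq_iff forall_3)

lemma mat3_eq_iff [simp]:
  "mat3 a b c d e f g h i = mat3 a' b' c' d' e' f' g' h' i' \<longleftrightarrow>
    a = a' \<and> b = b' \<and> c = c' \<and> d = d' \<and> e = e' \<and> f = f' \<and> g = g' \<and> h = h' \<and> i = i'"
  by (simp add: matrix3_eq_iff)

lemma mat3_cases:
  fixes A :: "real^3^3"
  obtains a b c d e f g h i where "A = mat3 a b c d e f g h i"
proof
  show "A = mat3 (A $ 1 $ 1) (A $ 1 $ 2) (A $ 1 $ 3) (A $ 2 $ 1) (A $ 2 $ 2) (A $ 2 $ 3)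
    (A $ 3 $ 1) (A $ 3 $ 2) (A $ 3 $ 3)"
    by (simp add: matrix3_eq_iff)
qed

lemma mat3_mult [simp]:
  "mat3 a b c d e f g h i ** mat3 a' b' c' d' e' f' g' h' i' =
    mat3 (a * a' + b * d' + c * g') (a * b' + b * e' + c * h') (a * c' + b * f' + c * i')
      (d * a' + e * d' + f * g') (d * b' + e * e' + f * h') (d * c' + e * f' + f * i')
      (g * a' + h * d' + i * g') (g * b' + h * e' + i * h') (g * c' + h * f' + i * i')"
  by (simp add: matrix3_eq_iff matrix_matrix_mult_def sum_3)

lemma mat3_transpose [simp]:
  "transpose (mat3 a b c d e f g h i) = mat3 a d g b e h c f i"
  by (simp add: matrix3_eq_iff transpose_def)

lemma mat3_uminus [simp]:
  "- mat3 a b c d e f g h i = mat3 (- a) (- b) (- c) (- d) (- e) (- f) (- g) (- h) (- i)"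
  by (simp add: matrix3_eq_iff)

lemma mat_1_eq_mat3: "mat 1 = mat3 1 0 0 0 1 0 0 0 1"
  by (simp add: matrix3_eq_iff mat_def)

lemma rot_e3: "rot e3 t = mat3 (cos t) (- sin t) 0 (sin t) (cos t) 0 0 0 1"
  by (simp add: rot_def matrix3_eq_iff matrix_def cross3_simps axis_def sgn_div_norm
      norm_vec_def L2_set_def sum_3 inner_vec_def)

lemma rot_e1_pi: "rot e1 pi = mat3 1 0 0 0 (-1) 0 0 0 (-1)"
  by (simp add: rot_def matrix3_eq_iff matrix_def cross3_simps axis_def sgn_div_norm
      norm_vec_def L2_set_def sum_3 inner_vec_def)

lemma cos_sin_two_pi_thirds: "cos (2 * pi / 3) = - 1 / 2" "sin (2 * pi / 3) = sqrt 3 / 2"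
proof -
  have "2 * pi / 3 = pi - pi / 3" by simp
  then show "cos (2 * pi / 3) = - 1 / 2" "sin (2 * pi / 3) = sqrt 3 / 2"
    by (simp_all only: cos_pi_minus sin_pi_minus) (simp_all add: cos_60 sin_60)
qed

lemma rot_diagonal: "rot (e1 + e2 + e3) (2 * pi / 3) = mat3 0 0 1 1 0 0 0 1 0"
proof -
  have s: "sgn (e1 + e2 + e3) = vector [1 / sqrt 3, 1 / sqrt 3, 1 / sqrt 3]"
    by (simp add: vec_eq_iff forall_3 axis_def sgn_div_norm norm_vec_def L2_set_def sum_3 
        inverse_eq_divide)
  show ?thesis
    unfolding rot_def s cos_sin_two_pi_thirds
    by (simp add: matrix3_eq_iff matrix_def cross3_simps axis_def
      sum_3 inner_vec_def field_simps)
qed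

section \<open>The orthogonal group as a matrix group\<close>

lemma O3_simps [simp]:
  "A \<in> carrier O3 \<longleftrightarrow> orthogonal_matrix A" "A \<otimes>\<^bsub>O3\<^esub> B = A ** B" "\<one>\<^bsub>O3\<^esub> = mat 1"
  by (simp_all add: O3_def)

lemma inv_O3 [simp]:
  assumes "orthogonal_matrix A"
  shows "inv\<^bsub>O3\<^esub> A = transpose A"
proof -
  interpret group O3 by (rule group_O3)
  show ?thesis
    using assms by (intro inv_equality) (simp_all add: orthogonal_matrix_def orthogonal_matrix_transpose)
qed

lemma subgroup_O3I:
  assumes "H \<subseteq> carrier O3" "mat 1 \<in> H" "\<And>A B. A \<in> H \<Longrightarrow> B \<in> H \<Longrightarrow> A ** B \<in> H"
    and "\<And>A. A \<in> H \<Longrightarrow> transpose A \<in> H"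
  shows "subgroup H O3"
  using assms by unfold_locales auto

lemma subgroup_O3D:
  assumes "subgroup H O3"
  shows "A \<in> H \<Longrightarrow> orthogonal_matrix A" "mat 1 \<in> H" "A \<in> H \<Longrightarrow> B \<in> H \<Longrightarrow> A ** B \<in> H"
    "A \<in> H \<Longrightarrow> transpose A \<in> H"
proof -
  show o: "A \<in> H \<Longrightarrow> orthogonal_matrix A"
    using subgroup.mem_carrier[OF assms] by auto
  show "mat 1 \<in> H" "A \<in> H \<Longrightarrow> B \<in> H \<Longrightarrow> A ** B \<in> H"
    using subgroup.one_closed[OF assms] subgroup.m_closed[OF assms] by auto
  show "A \<in> H \<Longrightarrow> transpose A \<in> H"
    using subgroup.m_inv_closed[OF assms, of A] o by auto
qed

lemma conj_by_eq_image:
  "orthogonal_matrix g \<Longrightarrow> conj_by g H = (\<lambda>h. g ** h ** transpose g) ` H"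
  by (simp add: conj_by_image)

lemma mem_conj_by:
  assumes "orthogonal_matrix g"
  shows "A \<in> conj_by g H \<longleftrightarrow> transpose g ** A ** g \<in> H"
proof -
  have g: "transpose g ** g = mat 1" "g ** transpose g = mat 1"
    using assms by (simp_all add: orthogonal_matrix_def)
  have 1: "transpose g ** (g ** h ** transpose g) ** g = h" for h
    by (metis g(1) matrix_mul_assoc matrix_mul_lid matrix_mul_rid)
  have 2: "g ** (transpose g ** A ** g) ** transpose g = A"
    by (metis g(2) matrix_mul_assoc matrix_mul_lid matrix_mul_rid)
  show ?thesis
    unfolding conj_by_eq_image[OF assms] using 1 2 by (metis (no_types, lifting) image_iff)
qed

lemma subgroup_conj_by:
  assumes g: "orthogonal_matrix g" and H: "subgroup H O3"
  shows "subgroup (conj_by g H) O3"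
proof (rule subgroup_O3I)
  have gg: "transpose g ** g = mat 1" "g ** transpose g = mat 1"
    using g by (simp_all add: orthogonal_matrix_def)
  show "conj_by g H \<subseteq> carrier O3"
    using g subgroup.subset[OF H] by (intro conj_by_closed) auto
  show "mat 1 \<in> conj_by g H"
    using subgroup_O3D(2)[OF H] by (simp add: mem_conj_by[OF g] gg)
  show "A ** B \<in> conj_by g H" if "A \<in> conj_by g H" "B \<in> conj_by g H" for A B
  proof -
    have "transpose g ** (A ** B) ** g = transpose g ** A ** (g ** transpose g) ** B ** g"
      by (simp add: gg matrix_mul_assoc)
    also have "\<dots> = transpose g ** A ** g ** (transpose g ** B ** g)"
      by (simp only: matrix_mul_assoc)
    finally have "transpose g ** (A ** B) ** g = transpose g ** A ** g ** (transpose g ** B ** g)" .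
    then show ?thesis
      using that subgroup_O3D(3)[OF H] by (simp add: mem_conj_by[OF g])
  qed
  show "transpose A \<in> conj_by g H" if "A \<in> conj_by g H" for A
    using that subgroup_O3D(4)[OF H, of "transpose g ** A ** g"]
    by (simp add: mem_conj_by[OF g] matrix_transpose_mul matrix_mul_assoc)
qed

lemma conj_by_subgroup_self:
  assumes H: "subgroup H O3" and g: "g \<in> H"
  shows "conj_by g H = H"
proof -
  note D = subgroup_O3D[OF H]
  have o: "orthogonal_matrix g" using D(1) g .
  have gg: "transpose g ** g = mat 1" "g ** transpose g = mat 1"
    using o by (simp_all add: orthogonal_matrix_def)
  have "A \<in> H" if "transpose g ** A ** g \<in> H" for A
  proof -
    have "g ** (transpose g ** A ** g) ** transpose g = A"
      by (metis gg(2) matrix_mul_assoc matrix_mul_lid matrix_mul_rid)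
    moreover have "g ** (transpose g ** A ** g) ** transpose g \<in> H"
      by (intro D(3) D(4) g that)
    ultimately show ?thesis by simp
  qed
  moreover have "transpose g ** A ** g \<in> H" if "A \<in> H" for A
    by (intro D(3) D(4) g that)
  ultimately have "A \<in> conj_by g H \<longleftrightarrow> A \<in> H" for A
    unfolding mem_conj_by[OF o] by blast
  then show ?thesis by blast
qed

lemma orthogonal_mat3_iff:
  "orthogonal_matrix (mat3 a b c d e f g h i) \<longleftrightarrow>
    (a * a + b * b + c * c = 1 \<and> d * d + e * e + f * f = 1 \<and> g * g + h * h + i * i = 1 \<and>
     a * d + b * e + c * f = 0 \<and> a * g + b * h + c * i = 0 \<and> d * g + e * h + f * i = 0)"
  unfolding orthogonal_matrix_def
  by (subst matrix_left_right_inverse)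
    (simp add: mat_1_eq_mat3 mult.commute, blast)

section \<open>Signed permutation matrices and the tetrahedral symmetry group\<close>

definition unit_entries :: "real^3^3 \<Rightarrow> bool"
  where "unit_entries A \<longleftrightarrow> (\<forall>i j. A $ i $ j \<in> {-1, 0, 1})"

definition signed_perms :: "(real^3^3) set"
  where "signed_perms = {A. orthogonal_matrix A \<and> unit_entries A}"

text \<open>The full symmetry group of the regular tetrahedron with vertices \<open>(1, 1, 1)\<close>,
  \<open>(1, -1, -1)\<close>, \<open>(-1, 1, -1)\<close>, \<open>(-1, -1, 1)\<close>: these are the vertices of the cube at which
  \<open>xyz\<close> is positive. Phrased as invariance of a polynomial, it is a group without any
  multiplication table.\<close>

definition tetra_full :: "(real^3^3) set"
  where "tetra_full = {A \<in> signed_perms.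
    \<forall>x. (A *v x) $ 1 * (A *v x) $ 2 * (A *v x) $ 3 = x $ 1 * x $ 2 * x $ 3}"

abbreviation "id3 \<equiv> mat3 1 0 0 0 1 0 0 0 1"
abbreviation "half1 \<equiv> mat3 1 0 0 0 (-1) 0 0 0 (-1)"
abbreviation "half2 \<equiv> mat3 (-1) 0 0 0 1 0 0 0 (-1)"
abbreviation "half3 \<equiv> mat3 (-1) 0 0 0 (-1) 0 0 0 1"
abbreviation "cyc \<equiv> mat3 0 0 1 1 0 0 0 1 0"
abbreviation "cyc2 \<equiv> mat3 0 1 0 0 0 1 1 0 0"
abbreviation "swap12 \<equiv> mat3 0 1 0 1 0 0 0 0 1"
abbreviation "swap13 \<equiv> mat3 0 0 1 0 1 0 1 0 0"
abbreviation "swap23 \<equiv> mat3 1 0 0 0 0 1 0 1 0"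

text \<open>The coordinate half-turns and the permutation matrices, the two factors of the semidirect
  product. All matrices are given by their entries so that products evaluate by simplification.\<close>

definition klein4 :: "(real^3^3) set" where "klein4 = {id3, half1, half2, half3}"

definition perms3 :: "(real^3^3) set"
  where "perms3 = {id3, cyc, cyc2, swap12, swap13, swap23}"

lemma unit_entries_mat3 [simp]:
  "unit_entries (mat3 a b c d e f g h i) \<longleftrightarrow>
    a \<in> {-1, 0, 1} \<and> b \<in> {-1, 0, 1} \<and> c \<in> {-1, 0, 1} \<and> d \<in> {-1, 0, 1} \<and> e \<in> {-1, 0, 1} \<and>
    f \<in> {-1, 0, 1} \<and> g \<in> {-1, 0, 1} \<and> h \<in> {-1, 0, 1} \<and> i \<in> {-1, 0, 1}"
  by (simp only: unit_entries_def forall_3 mat3_nth conj_assoc)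

text \<open>Integrality of the entries is visibly preserved by products, membership in
  \<open>{-1, 0, 1}\<close> is not; for orthogonal matrices the two agree because the rows are unit vectors.\<close>

lemma int_entries_imp_unit_entries:
  fixes A :: "real^3^3"
  assumes A: "orthogonal_matrix A" and int: "\<And>i j. A $ i $ j \<in> \<int>"
  shows "unit_entries A"
  unfolding unit_entries_def
proof (intro allI)
  fix i j
  obtain k where k: "A $ i $ j = of_int k" using int by (meson Ints_cases)
  have "norm (A $ i) = 1"
    using A by (simp add: orthogonal_matrix_orthonormal_rows row_def)
  then have "\<bar>A $ i $ j\<bar> \<le> 1" using component_le_norm_cart[of "A $ i" j] by simp
  then have "\<bar>k\<bar> \<le> 1" using k by linarith
  then have "k \<in> {-1, 0, 1}" by auto
  then show "A $ i $ j \<in> {-1, 0, 1}" using k by auto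
qed

lemma subgroup_signed_perms: "subgroup signed_perms O3"
proof (rule subgroup_O3I)
  have int: "A $ i $ j \<in> \<int>" if "A \<in> signed_perms" for A i j
  proof -
    have "A $ i $ j \<in> {-1, 0, 1}" using that by (simp add: signed_perms_def unit_entries_def)
    then show ?thesis by auto
  qed
  show "A ** B \<in> signed_perms" if "A \<in> signed_perms" "B \<in> signed_perms" for A B
  proof -
    have "orthogonal_matrix (A ** B)"
      using that by (simp add: signed_perms_def orthogonal_matrix_mul)
    moreover have "(A ** B) $ i $ j \<in> \<int>" for i j
      using int[OF that(1)] int[OF that(2)] by (simp add: matrix_matrix_mult_def sum_3)
    ultimately show ?thesis
      using int_entries_imp_unit_entries by (simp add: signed_perms_def)
  qed
  show "mat 1 \<in> signed_perms"
    by (simp add: signed_perms_def mat_1_eq_mat3 orthogonal_mat3_iff)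
  show "transpose A \<in> signed_perms" if "A \<in> signed_perms" for A
    using that unfolding signed_perms_def mem_Collect_eq orthogonal_matrix_transpose
    by (simp add: unit_entries_def transpose_def)
qed (auto simp: signed_perms_def)

lemma unit_row_cases:
  fixes a b c :: real
  assumes "a \<in> {-1, 0, 1}" "b \<in> {-1, 0, 1}" "c \<in> {-1, 0, 1}" "a * a + b * b + c * c = 1"
  shows "a \<noteq> 0 \<and> b = 0 \<and> c = 0 \<or> a = 0 \<and> b \<noteq> 0 \<and> c = 0 \<or> a = 0 \<and> b = 0 \<and> c \<noteq> 0"
    and "a + b + c \<in> {-1, 1}"
  using assms by auto

text \<open>Every diagonal sign matrix is a product of coordinate half-turns up to a global sign.\<close>

lemma signed_perms_cases:
  assumes "A \<in> signed_perms"
  shows "\<exists>v\<in>klein4. \<exists>p\<in>perms3. A = v ** p \<or> A = - (v ** p)"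
proof -
  obtain a b c d e f g h i where A: "A = mat3 a b c d e f g h i" by (rule mat3_cases)
  have u: "a \<in> {-1, 0, 1}" "b \<in> {-1, 0, 1}" "c \<in> {-1, 0, 1}"
    "d \<in> {-1, 0, 1}" "e \<in> {-1, 0, 1}" "f \<in> {-1, 0, 1}"
    "g \<in> {-1, 0, 1}" "h \<in> {-1, 0, 1}" "i \<in> {-1, 0, 1}"
    using assms unfolding signed_perms_def A mem_Collect_eq unit_entries_mat3 by argo+
  have o: "a * a + b * b + c * c = 1" "d * d + e * e + f * f = 1" "g * g + h * h + i * i = 1"
    "a * d + b * e + c * f = 0" "a * g + b * h + c * i = 0" "d * g + e * h + f * i = 0"
    using assms unfolding signed_perms_def A mem_Collect_eq orthogonal_mat3_iff by argo+
  note r1 = unit_row_cases[OF u(1-3) o(1)]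
  note r2 = unit_row_cases[OF u(4-6) o(2)]
  note r3 = unit_row_cases[OF u(7-9) o(3)]
  \<comment> \<open>Each row has one nonzero entry, so its row sum is that entry.\<close>
  have "\<exists>p\<in>perms3. A = mat3 (a + b + c) 0 0 0 (d + e + f) 0 0 0 (g + h + i) ** p"
    using r1(1) r2(1) r3(1) o(4-6) unfolding A perms3_def by (elim disjE) simp_all
  moreover have "\<exists>v\<in>klein4. mat3 s 0 0 0 t 0 0 0 u = v \<or> mat3 s 0 0 0 t 0 0 0 u = - v"
    if "s \<in> {-1, 1}" "t \<in> {-1, 1}" "u \<in> {-1, 1}" for s t u
    using that by (auto simp: klein4_def)
  moreover have "(- v) ** p = - (v ** p)" for v p :: "real^3^3"
    by (cases v rule: mat3_cases, cases p rule: mat3_cases) simp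
  ultimately show ?thesis using r1(2) r2(2) r3(2) by metis
qed

lemma subgroup_tetra_full: "subgroup tetra_full O3"
proof (rule subgroup_O3I)
  note S = subgroup_O3D[OF subgroup_signed_perms]
  show "tetra_full \<subseteq> carrier O3" using S(1) by (auto simp: tetra_full_def)
  show "mat 1 \<in> tetra_full" using S(2) by (simp add: tetra_full_def)
  show "A ** B \<in> tetra_full" if "A \<in> tetra_full" "B \<in> tetra_full" for A B
    using that S(3) by (simp add: tetra_full_def flip: matrix_vector_mul_assoc)
  show "transpose A \<in> tetra_full" if A: "A \<in> tetra_full" for A
  proof -
    have "A ** transpose A = mat 1"
      using A S(1) by (simp add: tetra_full_def orthogonal_matrix_def)
    then have "A *v (transpose A *v x) = x" for x
      by (simp only: matrix_vector_mul_assoc matrix_vector_mul_lid)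
    moreover have "(A *v y) $ 1 * (A *v y) $ 2 * (A *v y) $ 3 = y $ 1 * y $ 2 * y $ 3" for y
      using A by (simp add: tetra_full_def)
    ultimately have "x $ 1 * x $ 2 * x $ 3 =
        (transpose A *v x) $ 1 * (transpose A *v x) $ 2 * (transpose A *v x) $ 3" for x
      by metis
    moreover have "transpose A \<in> signed_perms" using A S(4) by (simp add: tetra_full_def)
    ultimately show ?thesis unfolding tetra_full_def by (simp only: mem_Collect_eq simp_thms)
  qed
qed

text \<open>Evaluating \<open>xyz\<close> at \<open>(1, 1, 1)\<close> detects the global sign left open by
  \<open>signed_perms_cases\<close>.\<close>

lemma tetra_full_eq: "tetra_full = (\<Union>v\<in>klein4. (\<lambda>p. v ** p) ` perms3)"
proof
  show "tetra_full \<subseteq> (\<Union>v\<in>klein4. (\<lambda>p. v ** p) ` perms3)"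
  proof
    fix A assume A: "A \<in> tetra_full"
    then obtain v p where vp: "v \<in> klein4" "p \<in> perms3" "A = v ** p \<or> A = - (v ** p)"
      using signed_perms_cases[of A] unfolding tetra_full_def by blast
    have "(A *v vector [1, 1, 1]) $ 1 * (A *v vector [1, 1, 1]) $ 2 * (A *v vector [1, 1, 1]) $ 3 = 1"
      using A by (simp add: tetra_full_def)
    then have "A = v ** p"
      using vp by (auto simp: klein4_def perms3_def matrix_vector_mult_def sum_3)
    then show "A \<in> (\<Union>v\<in>klein4. (\<lambda>p. v ** p) ` perms3)" using vp by auto
  qed
  have "v \<in> tetra_full" if "v \<in> klein4" for v
    using that by (auto simp: klein4_def tetra_full_def signed_perms_def orthogonal_mat3_iff
        matrix_vector_mult_def sum_3)
  moreover have "p \<in> tetra_full" if "p \<in> perms3" for p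
    using that by (auto simp: perms3_def tetra_full_def signed_perms_def orthogonal_mat3_iff
        matrix_vector_mult_def sum_3)
  ultimately show "(\<Union>v\<in>klein4. (\<lambda>p. v ** p) ` perms3) \<subseteq> tetra_full"
    using subgroup_O3D(3)[OF subgroup_tetra_full] by auto
qed

lemmas tetra_full_explicit = tetra_full_eq[unfolded klein4_def perms3_def, simplified]

lemma subgroup_generate_O3: "S \<subseteq> carrier O3 \<Longrightarrow> subgroup (generate O3 S) O3"
  by (rule group.generate_is_subgroup[OF group_O3])

lemma klein4_cyc_in_Tet:
  "\<And>v. v \<in> klein4 \<Longrightarrow> v \<in> Tet" "cyc \<in> Tet"
proof -
  have s: "subgroup Tet O3"
    unfolding Tet_def rot_e3 rot_e1_pi rot_diagonal
    by (rule subgroup_generate_O3) (simp add: orthogonal_mat3_iff)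
  note D = subgroup_O3D[OF s]
  have g: "half3 \<in> Tet" "half1 \<in> Tet" "cyc \<in> Tet"
    unfolding Tet_def by (auto intro!: generate.incl simp: rot_e3 rot_e1_pi rot_diagonal)
  then show "cyc \<in> Tet" by simp
  have "half2 \<in> Tet" using D(3)[OF g(1,2)] by simp
  then show "v \<in> Tet" if "v \<in> klein4" for v
    using that g D(2) by (auto simp: klein4_def mat_1_eq_mat3)
qed

lemma Oct_minus_eq: "Oct_minus = tetra_full"
proof
  note D = subgroup_O3D[OF subgroup_tetra_full]
  have s: "subgroup Tet O3"
    unfolding Tet_def rot_e3 rot_e1_pi rot_diagonal
    by (rule subgroup_generate_O3) (simp add: orthogonal_mat3_iff)
  note T = subgroup_O3D[OF s]
  have q: "- rot e3 (pi / 2) = mat3 0 1 0 (-1) 0 0 0 0 (-1)" by (simp add: rot_e3)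
  have l: "(- rot e3 (pi / 2)) <#\<^bsub>O3\<^esub> Tet = (\<lambda>x. mat3 0 1 0 (-1) 0 0 0 0 (-1) ** x) ` Tet"
    by (auto simp: l_coset_def q)
  have "Tet \<subseteq> tetra_full"
    unfolding Tet_def
    by (rule group.generate_subgroup_incl[OF group_O3 _ subgroup_tetra_full])
      (simp add: rot_e3 rot_e1_pi rot_diagonal tetra_full_explicit)
  moreover have "mat3 0 1 0 (-1) 0 0 0 0 (-1) \<in> tetra_full" by (simp add: tetra_full_explicit)
  ultimately show "Oct_minus \<subseteq> tetra_full"
    unfolding Oct_minus_def l using D(3) by auto
  have c: "cyc \<in> Tet" "cyc2 \<in> Tet" using klein4_cyc_in_Tet(2) T(4) by fastforce+
  have t: "v ** p \<in> Tet" if "v \<in> klein4" "p \<in> {id3, cyc, cyc2}" for v p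
    using that klein4_cyc_in_Tet(1) T(2,3) c by (auto simp: mat_1_eq_mat3)
  \<comment> \<open>The transpositions fill the coset of \<open>- rot e3 (pi / 2)\<close>, a transposition up to signs.\<close>
  have r: "\<exists>v'\<in>klein4. \<exists>p'\<in>{id3, cyc, cyc2}. v ** p = mat3 0 1 0 (-1) 0 0 0 0 (-1) ** (v' ** p')"
    if "v \<in> klein4" "p \<in> {swap12, swap13, swap23}" for v p
    using that by (auto simp: klein4_def)
  show "tetra_full \<subseteq> Oct_minus"
  proof
    fix x assume "x \<in> tetra_full"
    then obtain v p where vp: "v \<in> klein4" "p \<in> perms3" "x = v ** p" by (auto simp: tetra_full_eq)
    consider "p \<in> {id3, cyc, cyc2}" | "p \<in> {swap12, swap13, swap23}"
      using vp(2) by (auto simp: perms3_def)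
    then show "x \<in> Oct_minus"
    proof cases
      case 1
      then show ?thesis using t vp by (simp add: Oct_minus_def)
    next
      case 2
      then show ?thesis using r[OF vp(1) 2] t vp(3) unfolding Oct_minus_def l by blast
    qed
  qed
qed

text \<open>The rotations of the cube contain the coordinate half-turns and every permutation matrix up
  to sign, since the negative of a transposition matrix is a half-turn about an axis parallel to a face diagonal.\<close>

lemma oplus_Oct_eq: "oplus_Z2c Oct = signed_perms"
proof
  note D = subgroup_O3D[OF subgroup_signed_perms]
  have s: "subgroup Oct O3"
    unfolding Oct_def rot_e3 rot_e1_pi rot_diagonal
    by (rule subgroup_generate_O3) (simp add: orthogonal_mat3_iff)
  note T = subgroup_O3D[OF s]
  have "Oct \<subseteq> signed_perms"
    unfolding Oct_def
    by (rule group.generate_subgroup_incl[OF group_O3 _ subgroup_signed_perms])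
      (simp add: rot_e3 rot_e1_pi rot_diagonal signed_perms_def orthogonal_mat3_iff)
  moreover have "- A \<in> signed_perms" if "A \<in> signed_perms" for A
  proof -
    have "orthogonal_matrix (- A)"
      using that by (cases A rule: mat3_cases) (simp add: signed_perms_def orthogonal_mat3_iff)
    moreover have "- (A $ i $ j) \<in> {-1, 0, 1}" for i j
    proof -
      have "A $ i $ j \<in> {-1, 0, 1}" using that by (simp add: signed_perms_def unit_entries_def)
      then show ?thesis by auto
    qed
    ultimately show ?thesis unfolding signed_perms_def unit_entries_def by simp
  qed
  ultimately show "oplus_Z2c Oct \<subseteq> signed_perms" by (auto simp: oplus_Z2c_def)
  have g: "mat3 0 (-1) 0 1 0 0 0 0 1 \<in> Oct" "half1 \<in> Oct" "cyc \<in> Oct"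
    unfolding Oct_def by (auto intro!: generate.incl simp: rot_e3 rot_e1_pi rot_diagonal)
  have h: "half3 \<in> Oct" "- swap12 \<in> Oct" "cyc2 \<in> Oct"
    using T(3)[OF g(1) g(1)] T(3)[OF g(2) g(1)] T(3)[OF g(3) g(3)] by simp_all
  have h2: "half2 \<in> Oct" using T(3)[OF g(2) h(1)] by simp
  have p: "- swap13 \<in> Oct" "- swap23 \<in> Oct" 
    using T(3)[OF g(3) h(2)] T(3)[OF h(3) h(2)] by simp_all
  have v: "v \<in> Oct" if "v \<in> klein4" for v
    using that g h h2 T(2) by (auto simp: klein4_def mat_1_eq_mat3)
  have p': "p \<in> Oct \<or> - p \<in> Oct" if "p \<in> perms3" for p
    using that g h p T(2) by (auto simp: perms3_def mat_1_eq_mat3)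
  have vp: "v ** p \<in> oplus_Z2c Oct \<and> - (v ** p) \<in> oplus_Z2c Oct"
    if "v \<in> klein4" "p \<in> perms3" for v p
  proof -
    have "v ** (- p) = - (v ** p)"
      by (cases v rule: mat3_cases, cases p rule: mat3_cases) simp
    then have "v ** p \<in> Oct \<or> - (v ** p) \<in> Oct" using v[OF that(1)] p'[OF that(2)] T(3) by metis
    then show ?thesis unfolding oplus_Z2c_def by (metis UnCI image_eqI minus_minus)
  qed
  then show "signed_perms \<subseteq> oplus_Z2c Oct" using signed_perms_cases by (metis subsetI)
qed

section \<open>Subgroups of the tetrahedral symmetry group\<close>

text \<open>The lifts of the transposition of the first two coordinates with sign product one:
  besides \<open>swap12\<close> the reflection in the plane \<open>x + y = 0\<close>, and the two rotary reflections
  \<open>- rot e3 (\<plusminus> pi / 2)\<close>.\<close>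

abbreviation "refl12 \<equiv> mat3 0 (-1) 0 (-1) 0 0 0 0 1"
abbreviation "rotrefl \<equiv> mat3 0 1 0 (-1) 0 0 0 0 (-1)"
abbreviation "rotrefl' \<equiv> mat3 0 (-1) 0 1 0 0 0 0 (-1)"

text \<open>Such an \<open>H\<close> meets the Klein group in \<open>{id3, half3}\<close>. As the Klein group is normal,
  conjugating \<open>half3\<close> within \<open>H\<close> cannot lead to another half-turn, so every element fixes the third
  axis. Multiplication by \<open>half3\<close> pairs up the four elements that exchange the first two
  axes, and the two pairs exclude each other because a product of one element from each is
  \<open>half1\<close> or \<open>half2\<close>.\<close>

lemma subgroup_with_one_half_turn:
  assumes H: "subgroup H O3" and sub: "H \<subseteq> tetra_full" and h3: "half3 \<in> H" and h1: "half1 \<notin> H"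
  shows "H \<in> {{id3, half3}, {id3, half3, swap12, refl12}, {id3, half3, rotrefl, rotrefl'}}"
proof -
  note D = subgroup_O3D[OF H]
  have h2: "half2 \<notin> H" using D(3)[OF _ h3, of half2] h1 by auto
  have id: "id3 \<in> H" using D(2) by (simp add: mat_1_eq_mat3)
  have six: "x \<in> {id3, half3, swap12, refl12, rotrefl, rotrefl'}" if x: "x \<in> H" for x
  proof -
    have c: "x ** half3 ** transpose x \<in> H" by (intro D(3) D(4) x h3)
    have "x \<in> tetra_full" using x sub by blast
    then show ?thesis
      using x c h1 h2 unfolding tetra_full_explicit by (elim insertE emptyE) simp_all
  qed
  have pair: "swap12 \<in> H \<longleftrightarrow> refl12 \<in> H" "rotrefl \<in> H \<longleftrightarrow> rotrefl' \<in> H"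
    using D(3)[OF h3, of swap12] D(3)[OF h3, of refl12] D(3)[OF h3, of rotrefl]
      D(3)[OF h3, of rotrefl'] by auto
  have not_both: "\<not> (swap12 \<in> H \<and> rotrefl \<in> H)"
    using D(3)[of rotrefl swap12] h1 by auto
  consider "swap12 \<in> H" | "rotrefl \<in> H" | "swap12 \<notin> H" "rotrefl \<notin> H" by blast
  then show ?thesis
  proof cases
    case 1
    then have "H = {id3, half3, swap12, refl12}" using six pair not_both id h3 by blast
    then show ?thesis by blast
  next
    case 2
    then have "H = {id3, half3, rotrefl, rotrefl'}" using six pair not_both id h3 by blast
    then show ?thesis by blast
  next
    case 3
    then have "H = {id3, half3}" using six pair id h3 by blast
    then show ?thesis by blast
  qed
qed

text \<open>If \<open>H\<close> meets the Klein group trivially, it has at most one element above each coordinate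
  permutation; once \<open>cyc\<close> belongs to \<open>H\<close>, these are the permutation matrices themselves.\<close>

lemma subgroup_with_cyc:
  assumes H: "subgroup H O3" and sub: "H \<subseteq> tetra_full" and cyc: "cyc \<in> H"
    and no: "half1 \<notin> H" "half2 \<notin> H" "half3 \<notin> H"
  shows "H \<in> {{id3, cyc, cyc2}, perms3}"
proof -
  note D = subgroup_O3D[OF H]
  have id: "id3 \<in> H" using D(2) by (simp add: mat_1_eq_mat3)
  have cyc2: "cyc2 \<in> H" using D(4)[OF cyc] by simp
  have six: "x \<in> perms3" if x: "x \<in> H" for x
  proof -
    \<comment> \<open>Above a cyclic permutation, one of the first two products is the sign part of \<open>x\<close>. Above a
      transposition, \<open>x\<close> inverts \<open>cyc\<close> modulo the Klein group, so the third product lies in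
      that group; it is the identity only if \<open>x\<close> has no signs.\<close>
    have "x ** cyc \<in> H" "x ** cyc2 \<in> H" "x ** cyc ** transpose x ** cyc \<in> H"
      by (intro D(3) D(4) x cyc cyc2)+
    moreover have "x \<in> tetra_full" using x sub by blast
    ultimately show ?thesis
      using x no unfolding tetra_full_explicit perms3_def by (elim insertE emptyE) simp_all
  qed
  have "swap12 \<in> H \<Longrightarrow> swap13 \<in> H" "swap12 \<in> H \<Longrightarrow> swap23 \<in> H"
    "swap23 \<in> H \<Longrightarrow> swap12 \<in> H" "swap13 \<in> H \<Longrightarrow> swap12 \<in> H"
    using D(3)[OF cyc, of swap12] D(3)[OF cyc2, of swap12] D(3)[OF cyc, of swap23]
      D(3)[OF cyc2, of swap13] by simp_all
  then show ?thesis using six id cyc cyc2 unfolding perms3_def by blast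
qed

text \<open>The eight rotations of order three are the conjugates of \<open>cyc\<close> by the Klein group and their
  inverses. Elements of order four have a half-turn as square, and the product of two
  distinct reflections is a half-turn or a rotation of order three; hence \<open>H\<close> contains
  at most one reflection and nothing else except the identity.\<close>

lemma subgroup_without_rotations:
  assumes H: "subgroup H O3" and sub: "H \<subseteq> tetra_full"
    and no: "half1 \<notin> H" "half2 \<notin> H" "half3 \<notin> H"
    and no3: "\<forall>v\<in>klein4. transpose v ** cyc ** v \<notin> H"
  shows "conj_class H \<in> {conj_class {id3}, conj_class {id3, swap12}}"
proof -
  note D = subgroup_O3D[OF H]
  let ?R = "{swap12, refl12, swap13, mat3 0 0 (-1) 0 1 0 (-1) 0 0, swap23, mat3 1 0 0 0 0 (-1) 0 (-1) 0}"
  have id: "id3 \<in> H" using D(2) by (simp add: mat_1_eq_mat3)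
  have no3': "cyc \<notin> H" "mat3 0 0 (-1) (-1) 0 0 0 1 0 \<notin> H" "mat3 0 0 (-1) 1 0 0 0 (-1) 0 \<notin> H"
    "mat3 0 0 1 (-1) 0 0 0 (-1) 0 \<notin> H"
    using no3 by (simp_all add: klein4_def)
  have refl: "x = id3 \<or> x \<in> ?R" if x: "x \<in> H" for x
  proof -
    have "x ** x \<in> H" "transpose x \<in> H" by (intro D(3) D(4) x)+
    moreover have "x \<in> tetra_full" using x sub by blast
    ultimately show ?thesis
      using x no no3' unfolding tetra_full_explicit by (elim insertE emptyE) simp_all
  qed
  have unique: "x = y" if x: "x \<in> H" "x \<in> ?R" and y: "y \<in> H" "y \<in> ?R" for x y
  proof -
    have "x ** y \<in> H" "y ** x \<in> H" by (intro D(3) x y)+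
    then show ?thesis using x(2) y(2) no no3' by (elim insertE emptyE) simp_all
  qed
  show ?thesis
  proof (cases "H = {id3}")
    case False
    then obtain x where x: "x \<in> H" "x \<in> ?R" using refl id by blast
    then have eq: "H = {id3, x}" using refl unique id by blast
    \<comment> \<open>\<open>half1\<close> exchanges the mirrors \<open>x = y\<close> and \<open>x + y = 0\<close>; \<open>cyc\<close> permutes the axes.\<close>
    have "\<exists>k\<in>{id3, half1, cyc, cyc2, cyc ** half1, cyc2 ** half1}. x = k ** swap12 ** transpose k"
      using x(2) by (elim insertE emptyE) simp_all
    then obtain k where k: "k \<in> {id3, half1, cyc, cyc2, cyc ** half1, cyc2 ** half1}"
      "x = k ** swap12 ** transpose k" by blast
    have o: "orthogonal_matrix k" using k(1) by (auto simp: orthogonal_mat3_iff)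
    have "H = conj_by k {id3, swap12}"
      unfolding eq conj_by_eq_image[OF o] k(2) using k(1) by auto
    then show ?thesis using o by (simp add: conj_class_conj_by orthogonal_mat3_iff)
  qed simp
qed

text \<open>Two of the half-turns generate the third, so \<open>H\<close> contains at most one. Conjugation by a
  power of \<open>cyc\<close> makes that one \<open>half3\<close>, and if there is none, conjugation by the Klein group
  turns any rotation of order three in \<open>H\<close> into \<open>cyc\<close> or its inverse.\<close>

lemma conj_class_subgroup_tetra_full:
  assumes H: "subgroup H O3" and sub: "H \<subseteq> tetra_full" and no: "\<not> klein4 \<subseteq> H"
  shows "conj_class H \<in> {conj_class {id3}, conj_class {id3, half3}, conj_class {id3, swap12},
    conj_class {id3, cyc, cyc2}, conj_class {id3, half3, rotrefl, rotrefl'},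
    conj_class {id3, half3, swap12, refl12}, conj_class perms3}"
proof -
  note D = subgroup_O3D[OF H]
  have id: "id3 \<in> H" using D(2) by (simp add: mat_1_eq_mat3)
  have conj: "subgroup (conj_by k H) O3 \<and> conj_by k H \<subseteq> tetra_full \<and>
      conj_class (conj_by k H) = conj_class H \<and> orthogonal_matrix k" if k: "k \<in> tetra_full" for k
  proof -
    have o: "orthogonal_matrix k" using subgroup_O3D(1)[OF subgroup_tetra_full] k .
    have "conj_by k H \<subseteq> conj_by k tetra_full"
      using sub by (auto simp: conj_by_eq_image[OF o])
    then show ?thesis
      using subgroup_conj_by[OF o H] conj_by_subgroup_self[OF subgroup_tetra_full k] o
        subgroup.subset[OF H] by (simp add: conj_class_conj_by)
  qed
  have two: "half1 \<in> H \<Longrightarrow> half2 \<notin> H" "half2 \<in> H \<Longrightarrow> half3 \<notin> H" "half3 \<in> H \<Longrightarrow> half1 \<notin> H"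
    using D(3)[of half1 half2] D(3)[of half2 half3] D(3)[of half3 half1] id no
    by (auto simp: klein4_def)
  consider (half) "half1 \<in> H \<or> half2 \<in> H \<or> half3 \<in> H"
    | (cyc) "half1 \<notin> H" "half2 \<notin> H" "half3 \<notin> H" "\<exists>v\<in>klein4. transpose v ** cyc ** v \<in> H"
    | (refl) "half1 \<notin> H" "half2 \<notin> H" "half3 \<notin> H" "\<forall>v\<in>klein4. transpose v ** cyc ** v \<notin> H"
    by blast
  then show ?thesis
  proof cases
    case half
    then have "\<exists>k\<in>{id3, cyc, cyc2}. transpose k ** half3 ** k \<in> H \<and> transpose k ** half1 ** k \<notin> H"
      using two by auto
    then obtain k where k: "k \<in> {id3, cyc, cyc2}" "transpose k ** half3 ** k \<in> H"
      "transpose k ** half1 ** k \<notin> H" by blast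
    have t: "k \<in> tetra_full" using k(1) by (auto simp: tetra_full_explicit)
    have o: "orthogonal_matrix k" using conj[OF t] by blast
    have "conj_by k H \<in> {{id3, half3}, {id3, half3, swap12, refl12}, {id3, half3, rotrefl, rotrefl'}}"
      using conj[OF t] k(2,3) by (intro subgroup_with_one_half_turn) (simp_all add: mem_conj_by)
    moreover have "conj_class H = conj_class (conj_by k H)" using conj[OF t] by blast
    ultimately show ?thesis by (elim insertE emptyE) simp_all
  next
    case cyc
    then obtain v where v: "v \<in> klein4" "transpose v ** cyc ** v \<in> H" by blast
    have t: "v \<in> tetra_full" using v(1) by (auto simp: tetra_full_explicit klein4_def)
    have h: "transpose v ** half1 ** v = half1" "transpose v ** half2 ** v = half2"
      "transpose v ** half3 ** v = half3"
      using v(1) by (auto simp: klein4_def)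
    have "conj_by v H \<in> {{id3, cyc, cyc2}, perms3}"
      using conj[OF t] v(2) cyc by (intro subgroup_with_cyc) (simp_all add: mem_conj_by h)
    moreover have "conj_class H = conj_class (conj_by v H)" using conj[OF t] by blast
    ultimately show ?thesis by (elim insertE emptyE) simp_all
  next
    case refl
    then show ?thesis using subgroup_without_rotations[OF H sub] by blast
  qed
qed

section \<open>Intersections containing the three half-turns\<close>

text \<open>The rotation by \<open>\<pi>/4\<close> about the third axis.\<close>

abbreviation "eighth_turn \<equiv> mat3 (sqrt 2 / 2) (- sqrt 2 / 2) 0 (sqrt 2 / 2) (sqrt 2 / 2) 0 0 0 1"

lemma orthogonal_eighth_turn: "orthogonal_matrix eighth_turn"
  by (simp add: orthogonal_mat3_iff field_simps)

lemma tetra_full_Int_conj_by: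
  assumes g: "orthogonal_matrix g"
  shows "tetra_full \<inter> conj_by g signed_perms =
    {x \<in> tetra_full. unit_entries (transpose g ** x ** g)}"
proof -
  have "orthogonal_matrix (transpose g ** x ** g)" if "x \<in> tetra_full" for x
    using subgroup_O3D(1)[OF subgroup_tetra_full that] g
    by (intro orthogonal_matrix_mul) (simp_all add: orthogonal_matrix_transpose)
  then show ?thesis by (auto simp: mem_conj_by[OF g] signed_perms_def)
qed

text \<open>Used to filter an explicit set. A conditional whose branches both contain the remaining set
  would double the term with every element, hence the union.\<close>

lemma Collect_mem_insert:
  "{x \<in> insert a A. P x} = (if P a then {a} else {}) \<union> {x \<in> A. P x}"
  by auto

text \<open>This group is \<open>\<D>\<^sub>4\<^sup>d\<close>.\<close>

lemma tetra_full_Int_conj_by_eighth_turn: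
  "tetra_full \<inter> conj_by eighth_turn signed_perms = klein4 \<union> {swap12, refl12, rotrefl, rotrefl'}"
proof -
  define s where "s = sqrt 2 / 2"
  have s: "s * s = 1 / 2" "- sqrt 2 / 2 = - s" by (simp_all add: s_def)
  have "s \<noteq> 0" "s \<noteq> 1" "s \<noteq> - 1" using s by auto
  then show ?thesis
    unfolding tetra_full_Int_conj_by[OF orthogonal_eighth_turn] 
    unfolding tetra_full_explicit Collect_mem_insert klein4_def s(2) s_def[symmetric]
    by (auto simp: s(1))
qed

lemma half_integral_row_cases:
  fixes A B C :: real
  assumes "2 * A - 1 \<in> {-1, 0, 1}" "2 * B - 1 \<in> {-1, 0, 1}" "2 * C - 1 \<in> {-1, 0, 1}" "A + B + C = 1"
  shows "(A, B, C) \<in> {(1, 0, 0), (0, 1, 0), (0, 0, 1), (0, 1/2, 1/2), (1/2, 0, 1/2), (1/2, 1/2, 0)}"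
proof -
  have x: "X = 0 \<or> X = 1 / 2 \<or> X = 1" if "2 * X - 1 \<in> {-1, 0, 1}" for X :: real
    using that by auto
  show ?thesis using x[OF assms(1)] x[OF assms(2)] x[OF assms(3)] assms(4)
    by (elim disjE) simp_all
qed

text \<open>Here \<open>A, \<dots>, I\<close> stand for the squared entries of an orthogonal matrix whose first
  two rows are \<open>(a, b, c)\<close> and \<open>(d, e, f)\<close>. The last hypothesis is \<open>ad + be + cf = 0\<close>
  squared until only squares are left. It rules out three rows with two entries \<open>1/2\<close> each and
  zeros in different columns, the only doubly stochastic pattern missing from the conclusion.\<close>

lemma half_integral_orthostochastic_cases:
  fixes A B C D E F G H I :: real
  assumes "(A, B, C) \<in> {(1, 0, 0), (0, 1, 0), (0, 0, 1), (0, 1/2, 1/2), (1/2, 0, 1/2), (1/2, 1/2, 0)}"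
    and "(D, E, F) \<in> {(1, 0, 0), (0, 1, 0), (0, 0, 1), (0, 1/2, 1/2), (1/2, 0, 1/2), (1/2, 1/2, 0)}"
    and "(G, H, I) \<in> {(1, 0, 0), (0, 1, 0), (0, 0, 1), (0, 1/2, 1/2), (1/2, 0, 1/2), (1/2, 1/2, 0)}"
    and c: "A + D + G = 1" "B + E + H = 1" "C + F + I = 1"
    and dot: "(A * D + B * E - C * F)\<^sup>2 = 4 * (A * D) * (B * E)"
  shows "(\<forall>X\<in>{A, B, C, D, E, F, G, H, I}. X \<in> {0, 1}) \<or>
    G \<in> {0, 1} \<and> H \<in> {0, 1} \<and> I \<in> {0, 1} \<and> A = D \<and> B = E \<and> C = F \<or>
    A \<in> {0, 1} \<and> B \<in> {0, 1} \<and> C \<in> {0, 1} \<and> D = G \<and> E = H \<and> F = I \<or>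
    D \<in> {0, 1} \<and> E \<in> {0, 1} \<and> F \<in> {0, 1} \<and> G = A \<and> H = B \<and> I = C"
proof -
  have "G = 1 - A - D" "H = 1 - B - E" "I = 1 - C - F" using c by linarith+
  then show ?thesis
    using assms(1-3) dot by hypsubst (elim insertE emptyE Pair_inject; hypsubst; simp)
qed

text \<open>The first two entries of each column are \<open>x\<close> and \<open>\<plusminus>x\<close> with \<open>x\<^sup>2 \<in> {0, 1/2}\<close>, so
  rotating the first two coordinates back by \<open>\<pi>/4\<close> leaves entries in \<open>{-1, 0, 1}\<close>.\<close>

lemma eighth_turn_mult_signed_perm:
  assumes o: "orthogonal_matrix (mat3 a b c d e f g h i)"
    and c: "a * a + d * d + g * g = 1" "b * b + e * e + h * h = 1" "c * c + f * f + i * i = 1"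
    and u: "g * g \<in> {0, 1}" "h * h \<in> {0, 1}" "i * i \<in> {0, 1}"
    and eq: "a * a = d * d" "b * b = e * e" "c * c = f * f"
  shows "\<exists>m\<in>signed_perms. mat3 a b c d e f g h i = eighth_turn ** m"
proof -
  let ?A = "mat3 a b c d e f g h i"
  let ?m = "transpose eighth_turn ** ?A"
  have t: "sqrt 2 / 2 * x + sqrt 2 / 2 * y \<in> {-1, 0, 1}"
    if "x * x = y * y" "x * x + y * y + z * z = 1" "z * z \<in> {0, 1}" for x y z :: real
  proof -
    have s: "x * x = 0 \<or> x * x = 1 / 2" using that by auto
    have "y = x \<or> y = - x" using that(1) by (metis square_eq_iff)
    then show ?thesis
    proof
      assume "y = x"
      then have y: "sqrt 2 / 2 * x + sqrt 2 / 2 * y = sqrt 2 * x" by simp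
      have "(sqrt 2 * x) * (sqrt 2 * x) = 2 * (x * x)" by (simp add: algebra_simps)
      then have "x * x = 0 \<or> (sqrt 2 * x) * (sqrt 2 * x) = 1" using s by argo
      then show ?thesis unfolding y by (auto simp: square_eq_1_iff)
    qed simp
  qed
  have z: "x \<in> {-1, 0, 1}" if "x * x \<in> {0, 1}" for x :: real
    using that by (auto simp: square_eq_1_iff)
  have "unit_entries ?m"
    using t[of a d g] t[of b e h] t[of c f i] t[of "- a" d g] t[of "- b" e h] t[of "- c" f i]
      z[OF u(1)] z[OF u(2)] z[OF u(3)] c u eq by simp
  moreover have "orthogonal_matrix ?m"
    using o orthogonal_eighth_turn by (intro orthogonal_matrix_mul) (simp_all only: orthogonal_matrix_transpose)
  moreover have "eighth_turn ** ?m = ?A"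
    using orthogonal_eighth_turn by (simp only: matrix_mul_assoc orthogonal_matrix_def matrix_mul_lid)
  ultimately have "?m \<in> signed_perms" "?A = eighth_turn ** ?m" by (simp_all only: signed_perms_def mem_Collect_eq)
  then show ?thesis by (rule bexI[rotated])
qed

text \<open>A half-turn about the \<open>i\<close>-th axis becomes \<open>2 u u\<^sup>T - 1\<close> under conjugation, where \<open>u\<close>
  is the \<open>i\<close>-th row of \<open>G\<close>. Its diagonal entries \<open>2 u\<^sub>j\<^sup>2 - 1\<close> lie in \<open>{-1, 0, 1}\<close>, which confines
  all squares to \<open>{0, 1/2, 1}\<close>. The power of \<open>cyc\<close> moves the one integral row to the bottom.\<close>

lemma half_turns_in_conj_signed_perms:
  assumes g: "orthogonal_matrix G" and sub: "klein4 \<subseteq> conj_by G signed_perms"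
  shows "G \<in> signed_perms \<or> (\<exists>k\<in>{id3, cyc, cyc2}. \<exists>m\<in>signed_perms. G = k ** (eighth_turn ** m))"
proof -
  obtain a b c d e f g h i where G: "G = mat3 a b c d e f g h i" by (rule mat3_cases)
  have o: "a * a + b * b + c * c = 1" "d * d + e * e + f * f = 1" "g * g + h * h + i * i = 1"
    "a * d + b * e + c * f = 0" "a * g + b * h + c * i = 0" "d * g + e * h + f * i = 0"
    using g unfolding G orthogonal_mat3_iff by argo+
  have "orthogonal_matrix (transpose G)" using g by (simp only: orthogonal_matrix_transpose)
  then have c: "a * a + d * d + g * g = 1" "b * b + e * e + h * h = 1" "c * c + f * f + i * i = 1"
    unfolding G mat3_transpose orthogonal_mat3_iff by argo+
  have m: "unit_entries (transpose G ** v ** G)" if "v \<in> klein4" for v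
    using that sub by (auto simp: mem_conj_by[OF g] signed_perms_def)
  have e: "(transpose G ** v ** G) $ j $ j \<in> {-1, 0, 1}" if "v \<in> klein4" for v j
    using m[OF that] unfolding unit_entries_def by blast
  have sq: "2 * (x * x) - 1 \<in> {-1, 0, 1}"
    if "x * x - y * y - z * z \<in> {-1, 0, 1}" "x * x + y * y + z * z = 1" for x y z :: real
  proof -
    have "2 * (x * x) - 1 = x * x - y * y - z * z" using that(2) by linarith
    then show ?thesis using that(1) by (simp only:)
  qed
  have r1: "2 * (a * a) - 1 \<in> {-1, 0, 1}" "2 * (b * b) - 1 \<in> {-1, 0, 1}" "2 * (c * c) - 1 \<in> {-1, 0, 1}"
    using sq[of a d g] e[of half1 1] c
      sq[of b e h] e[of half1 2] c
      sq[of c f i] e[of half1 3] c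
    by (simp_all add: G klein4_def algebra_simps)
  have r2: "2 * (d * d) - 1 \<in> {-1, 0, 1}" "2 * (e * e) - 1 \<in> {-1, 0, 1}" "2 * (f * f) - 1 \<in> {-1, 0, 1}"
    using sq[of d a g] e[of half2 1] c
      sq[of e b h] e[of half2 2] c
      sq[of f c i] e[of half2 3] c
    by (simp_all add: G klein4_def algebra_simps)
  have r3: "2 * (g * g) - 1 \<in> {-1, 0, 1}" "2 * (h * h) - 1 \<in> {-1, 0, 1}" "2 * (i * i) - 1 \<in> {-1, 0, 1}"
    using sq[of g a d] e[of half3 1] c
      sq[of h b e] e[of half3 2] c
      sq[of i c f] e[of half3 3] c
    by (simp_all add: G klein4_def algebra_simps)
  have c1: "orthogonal_matrix (cyc ** G)" "orthogonal_matrix (cyc2 ** G)"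
    using g by (simp_all add: orthogonal_matrix_mul orthogonal_mat3_iff)
  have "c * f = - (a * d + b * e)" using o(4) by linarith
  then have "(c * f) * (c * f) = (a * d + b * e) * (a * d + b * e)" by (simp only: minus_mult_minus)
  then have "(c * c) * (f * f) = (a * d + b * e)\<^sup>2" by (simp add: power2_eq_square ac_simps)
  then have dot: "((a * a) * (d * d) + (b * b) * (e * e) - (c * c) * (f * f))\<^sup>2 =
      4 * ((a * a) * (d * d)) * ((b * b) * (e * e))"
    by (simp add: power2_eq_square algebra_simps)
  from half_integral_orthostochastic_cases[OF half_integral_row_cases[OF r1 o(1)]
      half_integral_row_cases[OF r2 o(2)] half_integral_row_cases[OF r3 o(3)] c dot]
  show ?thesis
  proof (elim disjE)
    assume 1: "\<forall>x\<in>{a * a, b * b, c * c, d * d, e * e, f * f, g * g, h * h, i * i}. x \<in> {0, 1}"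
    have "x \<in> {-1, 0, 1}" if "x * x \<in> {0, 1}" for x :: real
      using that by (auto simp: square_eq_1_iff)
    then have "unit_entries G"
      unfolding G unit_entries_mat3 using 1 by (intro conjI) blast+
    then show ?thesis using g by (simp add: signed_perms_def)
  next
    assume 2: "g * g \<in> {0, 1} \<and> h * h \<in> {0, 1} \<and> i * i \<in> {0, 1} \<and> a * a = d * d \<and> b * b = e * e \<and> c * c = f * f"
    obtain m where "m \<in> signed_perms" "G = eighth_turn ** m"
      using eighth_turn_mult_signed_perm[of a b c d e f g h i] g c 2 unfolding G by blast
    then show ?thesis by (metis insertI1 mat_1_eq_mat3 matrix_mul_lid)
  next
    assume 3: "a * a \<in> {0, 1} \<and> b * b \<in> {0, 1} \<and> c * c \<in> {0, 1} \<and> d * d = g * g \<and> e * e = h * h \<and> f * f = i * i"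
    have "cyc2 ** G = mat3 d e f g h i a b c" by (simp add: G)
    then obtain m where m: "m \<in> signed_perms" "cyc2 ** G = eighth_turn ** m"
      using eighth_turn_mult_signed_perm[of d e f g h i a b c] c1 c 3 by (auto simp: algebra_simps)
    have "G = cyc ** (cyc2 ** G)" by (simp add: G)
    then show ?thesis using m by auto
  next
    assume 4: "d * d \<in> {0, 1} \<and> e * e \<in> {0, 1} \<and> f * f \<in> {0, 1} \<and> g * g = a * a \<and> h * h = b * b \<and> i * i = c * c"
    have "cyc ** G = mat3 g h i a b c d e f" by (simp add: G)
    then obtain m where m: "m \<in> signed_perms" "cyc ** G = eighth_turn ** m"
      using eighth_turn_mult_signed_perm[of g h i a b c d e f] c1 c 4 by (auto simp: algebra_simps)
    have "G = cyc2 ** (cyc ** G)" by (simp add: G)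
    then show ?thesis using m by auto
  qed
qed

lemma conj_class_Int_containing_half_turns:
  assumes g: "orthogonal_matrix g" and sub: "klein4 \<subseteq> conj_by g signed_perms"
  shows "conj_class (tetra_full \<inter> conj_by g signed_perms) \<in>
    {conj_class tetra_full, conj_class (klein4 \<union> {swap12, refl12, rotrefl, rotrefl'})}"
proof -
  note S = subgroup_O3D[OF subgroup_signed_perms]
  have carr: "signed_perms \<subseteq> carrier O3" "tetra_full \<subseteq> carrier O3"
    using subgroup.subset subgroup_signed_perms subgroup_tetra_full by blast+
  consider "g \<in> signed_perms" | k m where "k \<in> {id3, cyc, cyc2}" "m \<in> signed_perms" "g = k ** (eighth_turn ** m)"
    using half_turns_in_conj_signed_perms[OF g sub] by blast
  then show ?thesis
  proof cases
    case 1
    have "tetra_full \<inter> signed_perms = tetra_full" by (auto simp: tetra_full_def)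
    then show ?thesis using conj_by_subgroup_self[OF subgroup_signed_perms 1] by simp
  next
    case 2
    have k: "k \<in> tetra_full" using 2(1) by (auto simp: tetra_full_explicit)
    have o: "orthogonal_matrix k" "orthogonal_matrix m"
      using subgroup_O3D(1)[OF subgroup_tetra_full k] S(1) 2(2) by auto
    have "conj_by g signed_perms = conj_by k (conj_by eighth_turn (conj_by m signed_perms))"
      using o orthogonal_eighth_turn carr 2(3) by (simp add: conj_by_mult orthogonal_matrix_mul conj_by_closed)
    also have "\<dots> = conj_by k (conj_by eighth_turn signed_perms)"
      using conj_by_subgroup_self[OF subgroup_signed_perms 2(2)] by simp
    finally have "tetra_full \<inter> conj_by g signed_perms =
        conj_by k tetra_full \<inter> conj_by k (conj_by eighth_turn signed_perms)"
      using conj_by_subgroup_self[OF subgroup_tetra_full k] by simp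
    also have "\<dots> = conj_by k (tetra_full \<inter> conj_by eighth_turn signed_perms)"
      using o orthogonal_eighth_turn carr
      by (intro conj_by_Int[symmetric] conj_by_closed) (simp_all only: O3_simps)
    finally have "conj_class (tetra_full \<inter> conj_by g signed_perms) =
        conj_class (tetra_full \<inter> conj_by eighth_turn signed_perms)"
      using o carr by (simp only: conj_class_conj_by O3_simps le_infI1)
    then show ?thesis unfolding tetra_full_Int_conj_by_eighth_turn by blast
  qed
qed

section \<open>The listed point groups as explicit sets of matrices\<close>

lemma Z_rot_1: "Z_rot 1 = {id3}"
  by (auto simp: Z_rot_def rot_e3)

lemma Z_rot_2: "Z_rot 2 = {id3, half3}"
proof -
  have "Z_rot 2 = (\<lambda>j. rot e3 (2 * real j * pi / real 2)) ` {..<2}" by (auto simp: Z_rot_def)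
  also have "{..<2} = {0, 1 :: nat}" by auto
  finally show ?thesis by (simp add: rot_e3)
qed

lemma Z_rot_3:
  "Z_rot 3 = {id3, mat3 (-1/2) (- sqrt 3 / 2) 0 (sqrt 3 / 2) (-1/2) 0 0 0 1,
    mat3 (-1/2) (sqrt 3 / 2) 0 (- sqrt 3 / 2) (-1/2) 0 0 0 1}"
proof -
  have "Z_rot 3 = (\<lambda>j. rot e3 (2 * real j * pi / real 3)) ` {..<3}" by (auto simp: Z_rot_def)
  also have "{..<3} = {0, 1, 2 :: nat}" by auto
  finally have Z: "Z_rot 3 = {rot e3 0, rot e3 (2 * pi / 3), rot e3 (4 * pi / 3)}" by simp
  have "4 * pi / 3 = 2 * (2 * pi / 3)" by simp
  then have "cos (4 * pi / 3) = - 1 / 2" "sin (4 * pi / 3) = - sqrt 3 / 2"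
    by (simp_all only: cos_double sin_double cos_sin_two_pi_thirds) (simp_all add: power2_eq_square)
  then show ?thesis unfolding Z by (simp add: rot_e3 cos_sin_two_pi_thirds)
qed

lemma l_coset_O3: "A <#\<^bsub>O3\<^esub> H = (\<lambda>x. A ** x) ` H"
  by (auto simp: l_coset_def)

lemma Z2k_minus_1: "Z2k_minus 1 = {id3, mat3 1 0 0 0 1 0 0 0 (-1)}"
  unfolding Z2k_minus_def Z_rot_1 l_coset_O3 by (simp add: rot_e3 insert_commute)

lemma Z2k_minus_2: "Z2k_minus 2 = {id3, half3, rotrefl, rotrefl'}"
  unfolding Z2k_minus_def Z_rot_2 l_coset_O3 by (simp add: rot_e3 insert_commute)

lemma D_z_2: "D_z 2 = {id3, half3, mat3 (-1) 0 0 0 1 0 0 0 1, mat3 1 0 0 0 (-1) 0 0 0 1}"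
  unfolding D_z_def Z_rot_2 l_coset_O3 by (simp add: rot_e1_pi insert_commute)

lemma D_z_3:
  "D_z 3 = Z_rot 3 \<union> {mat3 (-1) 0 0 0 1 0 0 0 1,
    mat3 (1/2) (sqrt 3 / 2) 0 (sqrt 3 / 2) (-1/2) 0 0 0 1,
    mat3 (1/2) (- sqrt 3 / 2) 0 (- sqrt 3 / 2) (-1/2) 0 0 0 1}"
  unfolding D_z_def l_coset_O3 by (simp add: Z_rot_3 rot_e1_pi insert_commute)

lemma D_rot_2: "D_rot 2 = klein4"
proof
  have s: "subgroup klein4 O3"
    by (rule subgroup_O3I) (auto simp: klein4_def orthogonal_mat3_iff mat_1_eq_mat3)
  show "D_rot 2 \<subseteq> klein4"
    unfolding D_rot_def by (rule group.generate_subgroup_incl[OF group_O3 _ s])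
      (simp add: rot_e3 rot_e1_pi klein4_def)
  have t: "subgroup (D_rot 2) O3"
    unfolding D_rot_def by (rule subgroup_generate_O3) (simp add: rot_e3 rot_e1_pi orthogonal_mat3_iff)
  have "half3 \<in> D_rot 2" "half1 \<in> D_rot 2"
    unfolding D_rot_def by (auto intro!: generate.incl simp: rot_e3 rot_e1_pi)
  then show "klein4 \<subseteq> D_rot 2"
    using subgroup_O3D(2)[OF t] subgroup_O3D(3)[OF t, of half3 half1]
    by (simp add: klein4_def mat_1_eq_mat3)
qed

lemma D2k_d_2: "D2k_d 2 = klein4 \<union> {swap12, refl12, rotrefl, rotrefl'}"
  unfolding D2k_d_def D_rot_2 l_coset_O3 by (auto simp: klein4_def rot_e3)

lemma conj_class_eqI:
  "orthogonal_matrix k \<Longrightarrow> K \<subseteq> carrier O3 \<Longrightarrow> H = conj_by k K \<Longrightarrow> conj_class H = conj_class K"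
  by (simp add: conj_class_conj_by)

text \<open>The frame used here sends \<open>e3\<close>, the normal of the mirror in \<open>\<Z>\<^sub>2\<^sup>-\<close>, to the
  direction of \<open>e1 - e2\<close>.\<close>

lemma conj_class_Z2k_minus_1: "conj_class {id3, swap12} = conj_class (Z2k_minus 1)"
proof -
  let ?k = "mat3 (sqrt 2 / 2) 0 (sqrt 2 / 2) (sqrt 2 / 2) 0 (- sqrt 2 / 2) 0 1 0"
  have o: "orthogonal_matrix ?k" by (simp add: orthogonal_mat3_iff)
  have "{id3, swap12} = conj_by ?k (Z2k_minus 1)"
    unfolding conj_by_eq_image[OF o] Z2k_minus_1 by simp
  then show ?thesis
    by (intro conj_class_eqI[OF o]) (simp_all only: Z2k_minus_1, simp add: orthogonal_mat3_iff)
qed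

text \<open>Rotation by \<open>\<pi>/4\<close> takes the coordinate mirrors containing the third axis to the
  mirrors \<open>x = y\<close> and \<open>x + y = 0\<close>.\<close>

lemma conj_class_D_z_2: "conj_class {id3, half3, swap12, refl12} = conj_class (D_z 2)"
proof -
  have "{id3, half3, swap12, refl12} = conj_by eighth_turn (D_z 2)"
    unfolding conj_by_eq_image[OF orthogonal_eighth_turn] D_z_2 by (simp add: insert_commute)
  then show ?thesis
    by (intro conj_class_eqI[OF orthogonal_eighth_turn]) (simp_all only: D_z_2, simp add: orthogonal_mat3_iff)
qed

text \<open>The orthonormal frame along \<open>(1, -1, 0)\<close>, \<open>(1, 1, -2)\<close> and \<open>(1, 1, 1)\<close> carries the
  threefold axis \<open>e3\<close> to the diagonal and the mirror normal \<open>e1\<close> to that of \<open>swap12\<close>.\<close>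

lemma diagonal_frame:
  obtains k where "orthogonal_matrix k"
    and "{id3, cyc, cyc2} = conj_by k (Z_rot 3)" and "perms3 = conj_by k (D_z 3)"
proof -
  define p q where "p = sqrt 2 / 2" and "q = sqrt 3"
  have pq: "p * p = 1 / 2" "p * (p * x) = x / 2" "q * q = 3" "q * (q * x) = 3 * x" for x
    by (simp_all add: p_def q_def flip: mult.assoc)
  \<comment> \<open>\<open>p * q / 3\<close> is \<open>1 / sqrt 6\<close>.\<close>
  let ?k = "mat3 p (p * q / 3) (q / 3) (- p) (p * q / 3) (q / 3) 0 (- 2 * p * q / 3) (q / 3)"
  have o: "orthogonal_matrix ?k" by (simp add: orthogonal_mat3_iff algebra_simps pq)
  have Z: "{id3, cyc, cyc2} = conj_by ?k (Z_rot 3)"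
    unfolding conj_by_eq_image[OF o] Z_rot_3 q_def[symmetric]
    by (simp add: algebra_simps pq)
  have "perms3 = conj_by ?k (D_z 3)"
    unfolding D_z_3 conj_by_eq_image[OF o] image_Un Z[symmetric, unfolded conj_by_eq_image[OF o]]
      q_def[symmetric] perms3_def
    by (simp add: algebra_simps pq insert_commute)
  then show thesis using that o Z by blast
qed

lemma conj_class_Z_rot_3: "conj_class {id3, cyc, cyc2} = conj_class (Z_rot 3)"
  and conj_class_D_z_3: "conj_class perms3 = conj_class (D_z 3)"
proof -
  obtain k where k: "orthogonal_matrix k" "{id3, cyc, cyc2} = conj_by k (Z_rot 3)"
    "perms3 = conj_by k (D_z 3)" by (rule diagonal_frame)
  have "Z_rot 3 \<subseteq> carrier O3" "D_z 3 \<subseteq> carrier O3"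
    by (simp_all add: D_z_3 Z_rot_3 orthogonal_mat3_iff)
  then show "conj_class {id3, cyc, cyc2} = conj_class (Z_rot 3)"
    "conj_class perms3 = conj_class (D_z 3)"
    using conj_class_eqI[OF k(1)] k(2,3) by blast+
qed

section \<open>Realising the classes\<close>

text \<open>The numerical bounds decide that no nonzero rational multiple of \<open>s\<close> met below
  is \<open>1\<close> or \<open>-1\<close>.\<close>

lemma sqrt_half_facts:
  obtains s :: real where "s * s = 1 / 2" "\<And>x. s * (s * x) = x / 2" "7 / 10 < s" "s < 71 / 100"
proof
  have "(7 / 10)\<^sup>2 < (2::real) / 4" "(2::real) / 4 < (71 / 100)\<^sup>2" by (simp_all add: power2_eq_square)
  then show "7 / 10 < sqrt 2 / 2" "sqrt 2 / 2 < 71 / 100"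
    using real_less_rsqrt[of "7/5" 2] real_less_lsqrt[of "71/50" 2] by (simp_all add: power2_eq_square)
qed simp_all

text \<open>The group of signed permutations is put in general position.\<close>

lemma Int_conj_by_trivial:
  "\<exists>g. orthogonal_matrix g \<and> tetra_full \<inter> conj_by g signed_perms = {id3}"
proof (intro exI conjI)
  let ?g = "mat3 (2/15) (14/15) (1/3) (2/3) (-1/3) (2/3) (11/15) (2/15) (-2/3)"
  show o: "orthogonal_matrix ?g" by (simp add: orthogonal_mat3_iff)
  show "tetra_full \<inter> conj_by ?g signed_perms = {id3}"
    unfolding tetra_full_Int_conj_by[OF o]
    unfolding tetra_full_explicit Collect_mem_insert by (simp add: insert_commute)
qed

text \<open>The twofold axis of the cube along \<open>e1 + e2\<close> is moved to \<open>e3\<close>, and \<open>e3\<close> to the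
  generic horizontal direction \<open>(3/5, 4/5, 0)\<close>. Moving a fourfold axis to \<open>e3\<close> would
  add the rotary reflections of order four.\<close>

lemma Int_conj_by_Z_rot_2:
  "\<exists>g. orthogonal_matrix g \<and> tetra_full \<inter> conj_by g signed_perms = {id3, half3}"
proof -
  obtain s :: real where s: "s * s = 1 / 2" "\<And>x. s * (s * x) = x / 2" "7 / 10 < s" "s < 71 / 100"
    using sqrt_half_facts by blast
  let ?g = "mat3 (- s * 4 / 5) (s * 4 / 5) (3 / 5) (s * 3 / 5) (- s * 3 / 5) (4 / 5) s s 0"
  have o: "orthogonal_matrix ?g" by (simp add: orthogonal_mat3_iff s)
  have "tetra_full \<inter> conj_by ?g signed_perms = {id3, half3}"
    unfolding tetra_full_Int_conj_by[OF o]
    unfolding tetra_full_explicit Collect_mem_insert using s(3,4) by (simp add: s(1,2))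
  then show ?thesis using o by blast
qed

text \<open>A rotation about \<open>e1 - e2\<close>, the normal of the mirror of \<open>swap12\<close>, by an angle with
  cosine \<open>7/11\<close>. Cosines such as \<open>1/3\<close> would carry one diagonal of the cube to another and
  share a threefold axis.\<close>

lemma Int_conj_by_Z2k_minus_1:
  "\<exists>g. orthogonal_matrix g \<and> tetra_full \<inter> conj_by g signed_perms = {id3, swap12}"
proof (intro exI conjI)
  let ?g = "mat3 (9/11) (-2/11) (-6/11) (-2/11) (9/11) (-6/11) (6/11) (6/11) (7/11)"
  show o: "orthogonal_matrix ?g" by (simp add: orthogonal_mat3_iff)
  show "tetra_full \<inter> conj_by ?g signed_perms = {id3, swap12}"
    unfolding tetra_full_Int_conj_by[OF o]
    unfolding tetra_full_explicit Collect_mem_insert by (simp add: insert_commute)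
qed

text \<open>A rotation about the diagonal \<open>(1, 1, 1)\<close> by an angle with cosine \<open>1/7\<close>, which
  keeps the threefold axis and moves the mirrors through it.\<close>

lemma Int_conj_by_Z_rot_3:
  "\<exists>g. orthogonal_matrix g \<and> tetra_full \<inter> conj_by g signed_perms = {id3, cyc, cyc2}"
proof (intro exI conjI)
  let ?g = "mat3 (3/7) (-2/7) (6/7) (6/7) (3/7) (-2/7) (-2/7) (6/7) (3/7)"
  show o: "orthogonal_matrix ?g" by (simp add: orthogonal_mat3_iff)
  show "tetra_full \<inter> conj_by ?g signed_perms = {id3, cyc, cyc2}"
    unfolding tetra_full_Int_conj_by[OF o]
    unfolding tetra_full_explicit Collect_mem_insert by (simp add: insert_commute)
qed

text \<open>A rotation about \<open>e3\<close> by an angle with cosine \<open>3/5\<close>, which moves the mirrors through \<open>e3\<close>.\<close>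

lemma Int_conj_by_Z2k_minus_2:
  "\<exists>g. orthogonal_matrix g \<and> tetra_full \<inter> conj_by g signed_perms = {id3, half3, rotrefl, rotrefl'}"
proof (intro exI conjI)
  let ?g = "mat3 (3/5) (-4/5) 0 (4/5) (3/5) 0 0 0 1"
  show o: "orthogonal_matrix ?g" by (simp add: orthogonal_mat3_iff)
  show "tetra_full \<inter> conj_by ?g signed_perms = {id3, half3, rotrefl, rotrefl'}"
    unfolding tetra_full_Int_conj_by[OF o]
    unfolding tetra_full_explicit Collect_mem_insert by (simp add: insert_commute)
qed

text \<open>The mutually orthogonal mirror normals \<open>e3\<close> and \<open>e1 + e2\<close> of the cube are sent to
  those of \<open>refl12\<close> and \<open>swap12\<close>. Then \<open>e3\<close> is the image of \<open>e1 - e2\<close>, an axis of order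
  only two.\<close>

lemma Int_conj_by_D_z_2:
  "\<exists>g. orthogonal_matrix g \<and> tetra_full \<inter> conj_by g signed_perms = {id3, half3, swap12, refl12}"
proof -
  obtain s :: real where s: "s * s = 1 / 2" "\<And>x. s * (s * x) = x / 2" "7 / 10 < s" "s < 71 / 100"
    using sqrt_half_facts by blast
  let ?g = "mat3 (1/2) (1/2) s (-1/2) (-1/2) s s (- s) 0"
  have o: "orthogonal_matrix ?g" by (simp add: orthogonal_mat3_iff s)
  have "tetra_full \<inter> conj_by ?g signed_perms = {id3, half3, swap12, refl12}"
    unfolding tetra_full_Int_conj_by[OF o]
    unfolding tetra_full_explicit Collect_mem_insert using s(3,4)
    by (simp add: s(1,2) insert_commute)
  then show ?thesis using o by blast
qed

text \<open>The half-turn about \<open>(1, 1, 1)\<close> preserves all mirrors through that axis, but none of the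
  coordinate axes.\<close>

lemma Int_conj_by_D_z_3:
  "\<exists>g. orthogonal_matrix g \<and> tetra_full \<inter> conj_by g signed_perms = perms3"
proof (intro exI conjI)
  let ?g = "mat3 (-1/3) (2/3) (2/3) (2/3) (-1/3) (2/3) (2/3) (2/3) (-1/3)"
  show o: "orthogonal_matrix ?g" by (simp add: orthogonal_mat3_iff)
  show "tetra_full \<inter> conj_by ?g signed_perms = perms3"
    unfolding tetra_full_Int_conj_by[OF o]
    unfolding tetra_full_explicit Collect_mem_insert perms3_def by (simp add: insert_commute)
qed

section \<open>The clips product\<close>

theorem lemma4p22:
  shows "clips (conj_class Oct_minus) (conj_class (oplus_Z2c Oct)) =
    {conj_class {mat 1}, conj_class (Z_rot 2), conj_class (Z2k_minus 1), conj_class (Z_rot 3),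
     conj_class (Z2k_minus 2), conj_class (D_z 2), conj_class (D_z 3), conj_class (D2k_d 2),
     conj_class Oct_minus}"
proof -
  have carr: "tetra_full \<subseteq> carrier O3" "signed_perms \<subseteq> carrier O3"
    using subgroup.subset subgroup_signed_perms subgroup_tetra_full by blast+
  define \<K> where "\<K> = {{id3}, {id3, half3}, {id3, swap12}, {id3, cyc, cyc2}, {id3, half3, rotrefl, rotrefl'},
    {id3, half3, swap12, refl12}, perms3, klein4 \<union> {swap12, refl12, rotrefl, rotrefl'}, tetra_full}"
  let ?H = "\<lambda>g. tetra_full \<inter> conj_by g signed_perms"
  have upper: "conj_class (?H g) \<in> conj_class ` \<K>" if g: "orthogonal_matrix g" for g
  proof (cases "klein4 \<subseteq> conj_by g signed_perms")
    case True
    then show ?thesis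
      using conj_class_Int_containing_half_turns[OF g] unfolding \<K>_def image_insert image_empty by blast
  next
    case False
    have "subgroup (?H g) O3"
      using group.subgroups_Inter_pair[OF group_O3 subgroup_tetra_full]
        subgroup_conj_by[OF g subgroup_signed_perms] by blast
    then show ?thesis
      using conj_class_subgroup_tetra_full[of "?H g"] False unfolding \<K>_def image_insert image_empty by blast
  qed
  have lower: "\<exists>g. orthogonal_matrix g \<and> ?H g = K" if "K \<in> \<K>" for K
  proof -
    have "?H (mat 1) = tetra_full"
      using conj_by_subgroup_self[OF subgroup_signed_perms] subgroup_O3D(2)[OF subgroup_signed_perms]
      by (auto simp: tetra_full_def)
    then have "\<exists>g. orthogonal_matrix g \<and> ?H g = tetra_full"
      using orthogonal_matrix_id by blast
    moreover have "\<exists>g. orthogonal_matrix g \<and> ?H g = klein4 \<union> {swap12, refl12, rotrefl, rotrefl'}"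
      using orthogonal_eighth_turn tetra_full_Int_conj_by_eighth_turn by blast
    ultimately show ?thesis
      using that Int_conj_by_trivial Int_conj_by_Z_rot_2 Int_conj_by_Z2k_minus_1 Int_conj_by_Z_rot_3
        Int_conj_by_Z2k_minus_2 Int_conj_by_D_z_2 Int_conj_by_D_z_3
      unfolding \<K>_def by - (elim insertE emptyE, simp_all only:)
  qed
  have "{conj_class (?H g) |g. g \<in> carrier O3} = conj_class ` \<K>"
  proof (intro equalityI subsetI)
    fix X assume "X \<in> {conj_class (?H g) |g. g \<in> carrier O3}"
    then obtain g where "orthogonal_matrix g" "X = conj_class (?H g)" unfolding O3_simps by blast
    then show "X \<in> conj_class ` \<K>" using upper by blast
  next
    fix X assume "X \<in> conj_class ` \<K>"
    then obtain K where K: "K \<in> \<K>" "X = conj_class K" by (rule imageE)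
    obtain g where "orthogonal_matrix g" "?H g = K" using lower[OF K(1)] by blast
    then show "X \<in> {conj_class (?H g) |g. g \<in> carrier O3}" unfolding O3_simps K(2) by blast
  qed
  also have "\<dots> = {conj_class {mat 1}, conj_class (Z_rot 2), conj_class (Z2k_minus 1), conj_class (Z_rot 3),
     conj_class (Z2k_minus 2), conj_class (D_z 2), conj_class (D_z 3), conj_class (D2k_d 2),
     conj_class tetra_full}"
    unfolding \<K>_def image_insert image_empty conj_class_Z2k_minus_1 conj_class_D_z_2
      conj_class_Z_rot_3 conj_class_D_z_3 Z2k_minus_2 Z_rot_2 D2k_d_2 mat_1_eq_mat3
    by blast
  finally show ?thesis
    unfolding Oct_minus_eq oplus_Oct_eq clips_conj_class[OF carr] .
qed

end
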